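(* Let $X$ be a splittable random process, and let $\sigma\in[0,\infty)$ be defined by \[ \frac{\sigma^2}{2}=\lim_{\substack{r\to\infty,\ \lambda\to 0\\ \lambda\log r\to 0}} \frac{1}{r\lambda^2}\log \mathbb{E}\exp\Big(\lambda\int_0^r X_t\,dt\Big). \] Assume $\sigma\neq0$. Then \[ \lim_{\substack{r\to\infty,\ c\to\infty\\ (c\log r)^2/r\to 0}}\frac{1}{c^2}\log\mathbb{P}\Big(\int_0^rX_t\,dt\ge c\,\sigma\sqrt r\Big)=-\frac12 , \] that is, for all sequences $r_n\to\infty$, $c_n\to\infty$ with $(c_n\log r_n)^2/r_n\to0$ one has $\frac1{c_n^2}\log\mathbb{P}\big(\int_0^{r_n}X_t\,dt\ge c_n\sigma\sqrt{r_n}\big)\to-\frac12$.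
   Context: A (random) process $X$ is a two-parameter family of real random variables on a probability space, denoted $\big(\int_\alpha^\beta X_t\,dt\big)_{-\infty<\alpha<\beta<\infty}$ (only a notation; no individual random variables $X_t$ are required to exist), satisfying $\int_\alpha^\beta X_t\,dt+\int_\beta^\gamma X_t\,dt=\int_\alpha^\gamma X_t\,dt$ for $\alpha<\beta<\gamma$. Two processes $X,Y$ (possibly on different probability spaces) are identically distributed if the random vectors $\big(\int_{\alpha_1}^{\beta_1}X_t\,dt,\dots,\int_{\alpha_n}^{\beta_n}X_t\,dt\big)$ and $\big(\int_{\alpha_1}^{\beta_1}Y_t\,dt,\dots,\int_{\alpha_n}^{\beta_n}Y_t\,dt\big)$ are identically distributed whenever $\alpha_1<\beta_1,\dots,\alpha_n<\beta_n$. The process is stationary if time shifts, sending $\int_\alpha^\beta X_t\,dt$ to $\int_{\alpha+s}^{\beta+s}X_t\,dt$, are measure preserving (the shifted process is distributed like $X$ for every $s\in\mathbb{R}$). It is centered if $\mathbb{E}\big|\int_\alpha^\beta X_t\,dt\big|<\infty$ and $\mathbb{E}\int_\alpha^\beta X_t\,dt=0$ for all $\alpha<\beta$. The measurability condition is: $r\mapsto\mathbb{E}\,\varphi\big(\int_0^rX_t\,dt\big)$ is a measurable function of $r\in(0,\infty)$ for every bounded continuous $\varphi:\mathbb{R}\to\mathbb{R}$. The $\sigma$-field generated by a process is the one generated by all $\int_\alpha^\beta X_t\,dt$; independence of processes means independence of the generated $\sigma$-fields. A centered stationary process $X$ satisfying the measurability condition is splittable if there exist $r>0$ and $\varepsilon>0$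 such that $\mathbb{E}\exp\big(\varepsilon\big|\int_0^rX_t\,dt\big|\big)<\infty$, and there exists (on some probability space) a triple of processes $X^0,X^-,X^+$ such that (a) the two processes $X^-,X^+$ are independent; (b) the four processes $X,X^0,X^-,X^+$ are identically distributed; (c) there exists a number $c>0$ such that for all $a,b>0$, \[ \mathbb{E}\exp\Big(c\Big|\int_{-a}^0X^-_t\,dt-\int_{-a}^0X^0_t\,dt\Big|+c\Big|\int_0^bX^+_t\,dt-\int_0^bX^0_t\,dt\Big|\Big)\le 2 . \] For every splittable process the limit defining $\sigma^2/2$ exists in $[0,\infty)$, in the following sense: for every $\varepsilon>0$ there exist $R$ and $\delta>0$ such that $\frac{1}{r\lambda^2}\log \mathbb{E}\exp(\lambda\int_0^r X_t\,dt)$ is within $\varepsilon$ of the limit for all $r\ge R$ and all $\lambda\ne0$ with $|\lambda|\log r\le\delta$. *)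

theory Defs
  imports "HOL-Probability.Probability"
begin

text \<open>
  A random process is encoded by \<open>X :: real \<Rightarrow> real \<Rightarrow> 'a \<Rightarrow> real\<close>, where \<open>X \<alpha> \<beta>\<close> stands for the random
  variable written $\int_\alpha^\beta X_t\,dt$; only the values at \<open>\<alpha> < \<beta>\<close> are meaningful.
  Identities between random variables are understood almost surely.
\<close>

definition process :: "'a measure \<Rightarrow> (real \<Rightarrow> real \<Rightarrow> 'a \<Rightarrow> real) \<Rightarrow> bool" where
  "process M X \<longleftrightarrow> prob_space M \<and>
     (\<forall>\<alpha> \<beta>. \<alpha> < \<beta> \<longrightarrow> X \<alpha> \<beta> \<in> borel_measurable M) \<and>
     (\<forall>\<alpha> \<beta> \<gamma>. \<alpha> < \<beta> \<and> \<beta> < \<gamma> \<longrightarrow> (AE \<omega> in M. X \<alpha> \<beta> \<omega> + X \<beta> \<gamma> \<omega> = X \<alpha> \<gamma> \<omega>))"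

definition identically_distributed ::
  "'a measure \<Rightarrow> (real \<Rightarrow> real \<Rightarrow> 'a \<Rightarrow> real) \<Rightarrow> 'b measure \<Rightarrow> (real \<Rightarrow> real \<Rightarrow> 'b \<Rightarrow> real) \<Rightarrow> bool" where
  "identically_distributed M X N Y \<longleftrightarrow>
     (\<forall>(n::nat) (\<alpha>::nat \<Rightarrow> real) (\<beta>::nat \<Rightarrow> real). (\<forall>i<n. \<alpha> i < \<beta> i) \<longrightarrow>
        distr M (\<Pi>\<^sub>M i\<in>{..<n}. borel) (\<lambda>\<omega>. \<lambda>i\<in>{..<n}. X (\<alpha> i) (\<beta> i) \<omega>) =
        distr N (\<Pi>\<^sub>M i\<in>{..<n}. borel) (\<lambda>\<omega>. \<lambda>i\<in>{..<n}. Y (\<alpha> i) (\<beta> i) \<omega>))"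

definition stationary :: "'a measure \<Rightarrow> (real \<Rightarrow> real \<Rightarrow> 'a \<Rightarrow> real) \<Rightarrow> bool" where
  "stationary M X \<longleftrightarrow>
     (\<forall>s. identically_distributed M (\<lambda>\<alpha> \<beta>. X (\<alpha> + s) (\<beta> + s)) M X)"

definition centered :: "'a measure \<Rightarrow> (real \<Rightarrow> real \<Rightarrow> 'a \<Rightarrow> real) \<Rightarrow> bool" where
  "centered M X \<longleftrightarrow>
     (\<forall>\<alpha> \<beta>. \<alpha> < \<beta> \<longrightarrow> integrable M (X \<alpha> \<beta>) \<and> (\<integral>\<omega>. X \<alpha> \<beta> \<omega> \<partial>M) = 0)"

text \<open>Measurability in \<open>r\<close> is taken in the sense of Lebesgue, which includes Borel measurability.\<close>

definition measurability_condition :: "'a measure \<Rightarrow> (real \<Rightarrow> real \<Rightarrow> 'a \<Rightarrow> real) \<Rightarrow> bool" where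
  "measurability_condition M X \<longleftrightarrow>
     (\<forall>\<phi>::real \<Rightarrow> real. continuous_on UNIV \<phi> \<and> bounded (range \<phi>) \<longrightarrow>
        (\<lambda>r. \<integral>\<omega>. \<phi> (X 0 r \<omega>) \<partial>M) \<in> borel_measurable (lebesgue_on {0<..}))"

definition generated_sigma_field :: "'a measure \<Rightarrow> (real \<Rightarrow> real \<Rightarrow> 'a \<Rightarrow> real) \<Rightarrow> 'a set set" where
  "generated_sigma_field M X =
     sigma_sets (space M) {X \<alpha> \<beta> -` B \<inter> space M | \<alpha> \<beta> B. \<alpha> < \<beta> \<and> B \<in> sets borel}"

definition independent_processes ::
  "'a measure \<Rightarrow> (real \<Rightarrow> real \<Rightarrow> 'a \<Rightarrow> real) \<Rightarrow> (real \<Rightarrow> real \<Rightarrow> 'a \<Rightarrow> real) \<Rightarrow> bool" where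
  "independent_processes M X Y \<longleftrightarrow>
     prob_space.indep_set M (generated_sigma_field M X) (generated_sigma_field M Y)"

text \<open>
  HOL cannot quantify existentially over types inside a formula, so the type \<open>'b\<close> of points of the
  probability space carrying the triple is a parameter.  A theorem that assumes
  \<open>splittable TYPE('b) M X\<close> for an arbitrary type variable \<open>'b\<close> covers a triple on any
  probability space whatsoever.
  Exponential moments are stated with the nonnegative integral because the Bochner integral is \<open>0\<close>
  for non-integrable functions.
\<close>

definition splittable :: "'b itself \<Rightarrow> 'a measure \<Rightarrow> (real \<Rightarrow> real \<Rightarrow> 'a \<Rightarrow> real) \<Rightarrow> bool" where
  "splittable (_ :: 'b itself) M X \<longleftrightarrow>
     process M X \<and> centered M X \<and> stationary M X \<and> measurability_condition M X \<and>
     (\<exists>r>0. \<exists>\<epsilon>>0. (\<integral>\<^sup>+\<omega>. ennreal (exp (\<epsilon> * \<bar>X 0 r \<omega>\<bar>)) \<partial>M) < \<infinity>) \<and>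
     (\<exists>(N :: 'b measure) X0 Xm Xp.
        process N X0 \<and> process N Xm \<and> process N Xp \<and>
        independent_processes N Xm Xp \<and>
        identically_distributed M X N X0 \<and>
        identically_distributed M X N Xm \<and>
        identically_distributed M X N Xp \<and>
        (\<exists>c>0. \<forall>a>0. \<forall>b>0.
           (\<integral>\<^sup>+\<omega>. ennreal (exp (c * \<bar>Xm (-a) 0 \<omega> - X0 (-a) 0 \<omega>\<bar> + c * \<bar>Xp 0 b \<omega> - X0 0 b \<omega>\<bar>)) \<partial>N) \<le> 2))"

text \<open>
  \<open>L\<close> is the limit of $\frac{1}{r\theta^2}\log \mathbb{E}\exp(\theta\int_0^r X_t\,dt)$ as
  $r\to\infty$, $\theta\to 0$, $\theta\log r\to 0$.  Being close to the real number \<open>L\<close> includes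
  finiteness of the expectation, which the Bochner integral alone would not express.
\<close>

definition has_log_mgf_limit :: "'a measure \<Rightarrow> (real \<Rightarrow> real \<Rightarrow> 'a \<Rightarrow> real) \<Rightarrow> real \<Rightarrow> bool" where
  "has_log_mgf_limit M X L \<longleftrightarrow>
     (\<forall>\<epsilon>>0. \<exists>R. \<exists>\<delta>>0. \<forall>r\<ge>R. \<forall>\<theta>. \<theta> \<noteq> 0 \<and> \<bar>\<theta>\<bar> * ln r \<le> \<delta> \<longrightarrow>
        integrable M (\<lambda>\<omega>. exp (\<theta> * X 0 r \<omega>)) \<and>
        \<bar>1 / (r * \<theta>\<^sup>2) * ln (\<integral>\<omega>. exp (\<theta> * X 0 r \<omega>) \<partial>M) - L\<bar> \<le> \<epsilon>)"

end

theory Submission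
  imports Defs
begin

text \<open>
  Put $k = c^2$ and $Y = \int_0^r X_t\,dt / (c\sigma\sqrt r)$.  Taking $\theta = s c/(\sigma\sqrt r)$
  in the hypothesis gives $k^{-1}\log \mathbb{E}\exp(s k Y) \to s^2/2$ for every $s > 0$, and the
  claim is the Gaertner--Ellis theorem in the Gaussian case.  The upper bound is Chernoff's
  inequality with $s = 1$.  For the lower bound tilt by $s = 1 + \eta$: the contributions of
  $Y < 1$ and of $Y > 1 + 2\eta$ to $\mathbb{E}\exp(s k Y)$ are both at most
  $\exp(k(1/2 + \eta + o(1)))$, which is negligible against $\exp(k s^2/2)$.
\<close>

text \<open>The window \<open>[1, 1 + 2 * \<eta>]\<close> is centred at \<open>1 + \<eta>\<close>,
  the mean of the limiting Gaussian after tilting by \<open>1 + \<eta>\<close>. To its left the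
  surplus factor \<open>exp (\<eta> * k * y)\<close> is at most its value at \<open>y = 1\<close>;
  to its right lowering the tilt by \<open>\<eta>\<close> costs at least the value at
  \<open>y = 1 + 2 * \<eta>\<close>. The indicator is that of \<open>{1..}\<close> rather than of
  the window, so that its integral is the tail probability itself.\<close>

lemma exp_split_at_window:
  fixes k \<eta> y :: real
  assumes "k > 0" "\<eta> > 0"
  shows "exp ((1 + \<eta>) * k * y) \<le> exp ((1 + \<eta>) * k * (1 + 2 * \<eta>)) * indicator {1..} y
    + exp (\<eta> * k) * exp (1 * k * y)
    + exp (- (\<eta> * k * (1 + 2 * \<eta>))) * exp ((1 + 2 * \<eta>) * k * y)"
proof -
  consider "y < 1" | "1 \<le> y" "y \<le> 1 + 2 * \<eta>" | "1 + 2 * \<eta> < y" by linarith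
  then show ?thesis
  proof cases
    case 1
    have "\<eta> * k * y \<le> \<eta> * k * 1"
      using 1 assms by (intro mult_left_mono) auto
    then have "(1 + \<eta>) * k * y \<le> \<eta> * k + 1 * k * y"
      by (simp add: algebra_simps)
    then have "exp ((1 + \<eta>) * k * y) \<le> exp (\<eta> * k) * exp (1 * k * y)"
      by (simp flip: exp_add)
    then show ?thesis
      by (smt (verit) exp_gt_zero indicator_pos_le mult_nonneg_nonneg)
  next
    case 2
    then have "exp ((1 + \<eta>) * k * y) \<le> exp ((1 + \<eta>) * k * (1 + 2 * \<eta>)) * indicator {1..} y"
      using assms by (auto intro!: mult_left_mono)
    then show ?thesis
      by (smt (verit) exp_gt_zero mult_nonneg_nonneg)
  next
    case 3
    have "\<eta> * k * (1 + 2 * \<eta>) \<le> \<eta> * k * y"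
      using 3 assms by (intro mult_left_mono) auto
    then have "(1 + \<eta>) * k * y \<le> - (\<eta> * k * (1 + 2 * \<eta>)) + (1 + 2 * \<eta>) * k * y"
      by (simp add: algebra_simps)
    then have "exp ((1 + \<eta>) * k * y)
        \<le> exp (- (\<eta> * k * (1 + 2 * \<eta>))) * exp ((1 + 2 * \<eta>) * k * y)"
      by (simp flip: exp_add)
    then show ?thesis
      by (smt (verit) exp_gt_zero indicator_pos_le mult_nonneg_nonneg)
  qed
qed

context prob_space
begin

text \<open>Chernoff's bound at tilt \<open>1\<close>, the minimiser of the Gaussian exponent
  \<open>s^2 / 2 - s\<close>.\<close>

lemma prob_ge_1_le_exp_moment:
  assumes [measurable]: "Y \<in> borel_measurable M"
    and "k > 0" "integrable M (\<lambda>\<omega>. exp (1 * k * Y \<omega>))"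
  shows "prob {\<omega> \<in> space M. Y \<omega> \<ge> 1} \<le> exp (- k) * expectation (\<lambda>\<omega>. exp (1 * k * Y \<omega>))"
proof -
  have "prob {\<omega> \<in> space M. Y \<omega> \<ge> 1} \<le> prob {\<omega> \<in> space M. exp k \<le> exp (1 * k * Y \<omega>)}"
    using \<open>k > 0\<close> by (intro finite_measure_mono) auto
  also have "\<dots> \<le> expectation (\<lambda>\<omega>. exp (1 * k * Y \<omega>)) / exp k"
    using assms by (intro integral_Markov_inequality_measure[where A = "{}"]) auto
  finally show ?thesis
    by (simp add: exp_minus field_simps)
qed

lemma exp_moment_split_at_window:
  assumes [measurable]: "Y \<in> borel_measurable M"
    and "k > 0" "\<eta> > 0"
    and int: "integrable M (\<lambda>\<omega>. exp (1 * k * Y \<omega>))"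
      "integrable M (\<lambda>\<omega>. exp ((1 + \<eta>) * k * Y \<omega>))"
      "integrable M (\<lambda>\<omega>. exp ((1 + 2 * \<eta>) * k * Y \<omega>))"
  shows "expectation (\<lambda>\<omega>. exp ((1 + \<eta>) * k * Y \<omega>))
    \<le> exp ((1 + \<eta>) * k * (1 + 2 * \<eta>)) * prob {\<omega> \<in> space M. Y \<omega> \<ge> 1}
      + exp (\<eta> * k) * expectation (\<lambda>\<omega>. exp (1 * k * Y \<omega>))
      + exp (- (\<eta> * k * (1 + 2 * \<eta>))) * expectation (\<lambda>\<omega>. exp ((1 + 2 * \<eta>) * k * Y \<omega>))"
proof -
  have ind: "integrable M (\<lambda>\<omega>. indicator {1..} (Y \<omega>) :: real)"
    by (rule integrable_const_bound[where B = 1]) auto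
  have "expectation (\<lambda>\<omega>. indicator {1..} (Y \<omega>))
      = expectation (indicator {\<omega> \<in> space M. Y \<omega> \<ge> 1} :: _ \<Rightarrow> real)"
    by (intro Bochner_Integration.integral_cong) (auto simp: indicator_def)
  then have prob: "expectation (\<lambda>\<omega>. indicator {1..} (Y \<omega>)) = prob {\<omega> \<in> space M. Y \<omega> \<ge> 1}"
    by simp
  have "expectation (\<lambda>\<omega>. exp ((1 + \<eta>) * k * Y \<omega>))
    \<le> expectation (\<lambda>\<omega>. exp ((1 + \<eta>) * k * (1 + 2 * \<eta>)) * indicator {1..} (Y \<omega>)
      + exp (\<eta> * k) * exp (1 * k * Y \<omega>)
      + exp (- (\<eta> * k * (1 + 2 * \<eta>))) * exp ((1 + 2 * \<eta>) * k * Y \<omega>))"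
    using int ind exp_split_at_window[OF \<open>k > 0\<close> \<open>\<eta> > 0\<close>]
    by (intro integral_mono Bochner_Integration.integrable_add integrable_mult_right) auto
  also have "\<dots> = exp ((1 + \<eta>) * k * (1 + 2 * \<eta>)) * prob {\<omega> \<in> space M. Y \<omega> \<ge> 1}
      + exp (\<eta> * k) * expectation (\<lambda>\<omega>. exp (1 * k * Y \<omega>))
      + exp (- (\<eta> * k * (1 + 2 * \<eta>))) * expectation (\<lambda>\<omega>. exp ((1 + 2 * \<eta>) * k * Y \<omega>))"
    using int ind prob by (simp add: integrable_mult_right del: mult_1)
  finally show ?thesis .
qed

text \<open>The main moment exceeds both side contributions by a factor whose exponent would be
  \<open>k * \<eta>^2 / 2\<close> if the moments were exactly Gaussian. An error of
  \<open>\<eta>^2 / 8\<close> in each moment still leaves the exponent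
  \<open>k * \<eta>^2 / 4\<close>. Positivity is a separate conclusion because \<open>ln\<close> of
  a zero probability would be a meaningless default value.\<close>

lemma ln_prob_ge_1_lower_bound:
  assumes Y: "Y \<in> borel_measurable M"
    and k: "k > 0" and \<eta>: "\<eta> > 0"
    and int: "integrable M (\<lambda>\<omega>. exp (1 * k * Y \<omega>))"
      "integrable M (\<lambda>\<omega>. exp ((1 + \<eta>) * k * Y \<omega>))"
      "integrable M (\<lambda>\<omega>. exp ((1 + 2 * \<eta>) * k * Y \<omega>))"
    and m1: "expectation (\<lambda>\<omega>. exp (1 * k * Y \<omega>)) \<le> exp (k * (1 / 2 + \<eta>\<^sup>2 / 8))"
    and m2: "exp (k * ((1 + \<eta>)\<^sup>2 / 2 - \<eta>\<^sup>2 / 8)) \<le> expectation (\<lambda>\<omega>. exp ((1 + \<eta>) * k * Y \<omega>))"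
    and m3: "expectation (\<lambda>\<omega>. exp ((1 + 2 * \<eta>) * k * Y \<omega>))
      \<le> exp (k * ((1 + 2 * \<eta>)\<^sup>2 / 2 + \<eta>\<^sup>2 / 8))"
    and large: "ln 4 \<le> k * \<eta>\<^sup>2 / 4"
  shows "prob {\<omega> \<in> space M. Y \<omega> \<ge> 1} > 0"
    and "k * (- (1 / 2) - 2 * \<eta> - 2 * \<eta>\<^sup>2) - ln 2 \<le> ln (prob {\<omega> \<in> space M. Y \<omega> \<ge> 1})"
proof -
  define p where "p = prob {\<omega> \<in> space M. Y \<omega> \<ge> 1}"
  \<comment> \<open>The exponent is \<open>(1 + \<eta>)^2 / 2 - \<eta>^2 / 8\<close> expanded, so
    \<open>A\<close> is the lower bound in \<open>m2\<close>. Both side contributions turn out to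
    have the same bound, \<open>1 / 2 + \<eta> + \<eta>^2 / 8\<close> in the exponent.\<close>
  define A where "A = exp (k * (1 / 2 + \<eta> + 3 * \<eta>\<^sup>2 / 8))"
  have "exp (\<eta> * k) * expectation (\<lambda>\<omega>. exp (1 * k * Y \<omega>))
      \<le> exp (\<eta> * k) * exp (k * (1 / 2 + \<eta>\<^sup>2 / 8))"
    using m1 by (intro mult_left_mono) auto
  also have "\<dots> = A * exp (- (k * \<eta>\<^sup>2 / 4))"
    by (simp add: A_def algebra_simps flip: exp_add)
  finally have 1: "exp (\<eta> * k) * expectation (\<lambda>\<omega>. exp (1 * k * Y \<omega>)) \<le> A * exp (- (k * \<eta>\<^sup>2 / 4))" .
  have "exp (- (\<eta> * k * (1 + 2 * \<eta>))) * expectation (\<lambda>\<omega>. exp ((1 + 2 * \<eta>) * k * Y \<omega>))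
      \<le> exp (- (\<eta> * k * (1 + 2 * \<eta>))) * exp (k * ((1 + 2 * \<eta>)\<^sup>2 / 2 + \<eta>\<^sup>2 / 8))"
    using m3 by (intro mult_left_mono) auto
  also have "\<dots> = A * exp (- (k * \<eta>\<^sup>2 / 4))"
    unfolding A_def exp_add[symmetric]
    by (rule arg_cong[of _ _ exp]) (simp add: field_simps power2_eq_square)
  finally have 2: "exp (- (\<eta> * k * (1 + 2 * \<eta>))) * expectation (\<lambda>\<omega>. exp ((1 + 2 * \<eta>) * k * Y \<omega>))
      \<le> A * exp (- (k * \<eta>\<^sup>2 / 4))" .
  have 3: "A \<le> expectation (\<lambda>\<omega>. exp ((1 + \<eta>) * k * Y \<omega>))"
    using m2 unfolding A_def by (simp add: field_simps power2_eq_square)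
  \<comment> \<open>By \<open>large\<close> each of the two side contributions is at most
    \<open>A / 4\<close>, which leaves \<open>A / 2\<close> for the event.\<close>
  have "exp (- (k * \<eta>\<^sup>2 / 4)) \<le> exp (- ln 4)"
    using large by simp
  also have "\<dots> = 1 / 4"
    by (simp add: exp_minus)
  finally have "A * exp (- (k * \<eta>\<^sup>2 / 4)) \<le> A * (1 / 4)"
    by (intro mult_left_mono) (auto simp: A_def)
  with 1 2 3 exp_moment_split_at_window[OF Y k \<eta> int]
  have main: "A / 2 \<le> exp ((1 + \<eta>) * k * (1 + 2 * \<eta>)) * p"
    unfolding p_def by linarith
  have A: "A > 0" by (simp add: A_def)
  with main have "0 < exp ((1 + \<eta>) * k * (1 + 2 * \<eta>)) * p" by linarith
  then have p: "p > 0" by (simp add: zero_less_mult_iff)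
  then show "prob {\<omega> \<in> space M. Y \<omega> \<ge> 1} > 0" by (simp add: p_def)
  have "ln (A / 2) \<le> ln (exp ((1 + \<eta>) * k * (1 + 2 * \<eta>)) * p)"
    using main A by (intro ln_mono) auto
  then have "k * (1 / 2 + \<eta> + 3 * \<eta>\<^sup>2 / 8) - ln 2 \<le> (1 + \<eta>) * k * (1 + 2 * \<eta>) + ln p"
    using A p by (simp add: ln_div ln_mult A_def)
  \<comment> \<open>The exact difference has \<open>- 13 / 8\<close> in front of
    \<open>\<eta>^2\<close>; it is rounded down to \<open>- 2\<close>.\<close>
  moreover have "k * (- (1 / 2) - 2 * \<eta> - 2 * \<eta>\<^sup>2)
      \<le> k * (1 / 2 + \<eta> + 3 * \<eta>\<^sup>2 / 8) - (1 + \<eta>) * k * (1 + 2 * \<eta>)"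
    using k \<eta> by (simp add: field_simps power2_eq_square)
  ultimately show "k * (- (1 / 2) - 2 * \<eta> - 2 * \<eta>\<^sup>2) - ln 2 \<le> ln (prob {\<omega> \<in> space M. Y \<omega> \<ge> 1})"
    unfolding p_def by linarith
qed

text \<open>The Legendre transform of \<open>s^2 / 2\<close> at \<open>1\<close> is
  \<open>1 / 2\<close>. Integrability is assumed apart from the limit because the Bochner integral
  of a non-integrable function is \<open>0\<close>. Measurability is asked only eventually, as for a
  normalised process that makes sense once its time horizon is positive.\<close>

theorem gaussian_Gaertner_Ellis:
  fixes k :: "nat \<Rightarrow> real"
  assumes meas: "\<forall>\<^sub>F n in sequentially. Y n \<in> borel_measurable M"
    and k: "filterlim k at_top sequentially"
    and int: "\<And>s. s > 0 \<Longrightarrow> \<forall>\<^sub>F n in sequentially. integrable M (\<lambda>\<omega>. exp (s * k n * Y n \<omega>))"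
    and lim: "\<And>s. s > 0 \<Longrightarrow>
      (\<lambda>n. 1 / k n * ln (expectation (\<lambda>\<omega>. exp (s * k n * Y n \<omega>)))) \<longlonglongrightarrow> s\<^sup>2 / 2"
  shows "(\<lambda>n. 1 / k n * ln (prob {\<omega> \<in> space M. Y n \<omega> \<ge> 1})) \<longlonglongrightarrow> - (1 / 2)"
proof -
  have k_pos: "\<forall>\<^sub>F n in sequentially. k n > 0"
    using k by (simp add: filterlim_at_top_dense)
  have moment: "\<forall>\<^sub>F n in sequentially.
      exp (k n * (s\<^sup>2 / 2 - e)) \<le> expectation (\<lambda>\<omega>. exp (s * k n * Y n \<omega>)) \<and>
      expectation (\<lambda>\<omega>. exp (s * k n * Y n \<omega>)) \<le> exp (k n * (s\<^sup>2 / 2 + e))"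
    if "s > 0" "e > 0" for s e :: real
    using tendstoD[OF lim[OF \<open>s > 0\<close>] \<open>e > 0\<close>] k_pos int[OF \<open>s > 0\<close>]
  proof eventually_elim
    case (elim n)
    let ?E = "expectation (\<lambda>\<omega>. exp (s * k n * Y n \<omega>))"
    \<comment> \<open>The bounds on \<open>ln ?E\<close> can be exponentiated only if
      \<open>?E\<close> is positive; a vanishing integral would force an exponential to vanish
      almost everywhere.\<close>
    have "\<not> ?E \<le> 0"
    proof
      assume "?E \<le> 0"
      moreover have "?E \<ge> 0" by simp
      ultimately have "AE \<omega> in M. exp (s * k n * Y n \<omega>) = 0"
        using integral_nonneg_eq_0_iff_AE[OF elim(3)] by simp
      then show False using AE_False by simp
    qed
    moreover have "k n * (s\<^sup>2 / 2 - e) \<le> ln ?E" "ln ?E \<le> k n * (s\<^sup>2 / 2 + e)"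
      using elim(1,2) by (auto simp: dist_real_def abs_less_iff field_simps)
    ultimately show ?case
      by (metis exp_le_cancel_iff exp_ln not_le)
  qed
  \<comment> \<open>Positivity of the probability is carried along: the upper bound also needs it
    before taking logarithms.\<close>
  have lower: "\<forall>\<^sub>F n in sequentially. prob {\<omega> \<in> space M. Y n \<omega> \<ge> 1} > 0 \<and>
      a < 1 / k n * ln (prob {\<omega> \<in> space M. Y n \<omega> \<ge> 1})"
    if "a < - (1 / 2)" for a :: real
  proof -
    \<comment> \<open>The rate in the lower bound tends to \<open>- 1 / 2\<close> as \<eta>
      decreases to \<open>0\<close>, so some positive \<eta> keeps it above
      \<open>a\<close>.\<close>
    have "((\<lambda>\<eta>. - (1 / 2) - 2 * \<eta> - 2 * \<eta>\<^sup>2) \<longlongrightarrow> - (1 / 2) - 2 * 0 - 2 * 0\<^sup>2) (at_right (0::real))"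
      by (intro tendsto_intros)
    then have "\<forall>\<^sub>F \<eta> in at_right 0. a < - (1 / 2) - 2 * \<eta> - 2 * \<eta>\<^sup>2"
      using that by (intro order_tendstoD(1)) auto
    then have "\<forall>\<^sub>F \<eta> in at_right 0. 0 < \<eta> \<and> a < - (1 / 2) - 2 * \<eta> - 2 * \<eta>\<^sup>2"
      using eventually_at_right_less eventually_conj by blast
    then obtain \<eta> where \<eta>: "0 < \<eta>" "a < - (1 / 2) - 2 * \<eta> - 2 * \<eta>\<^sup>2"
      using eventually_happens trivial_limit_at_right_real by blast
    have e: "\<eta>\<^sup>2 / 8 > 0" using \<eta> by simp
    \<comment> \<open>\<open>large1\<close> makes the side contributions negligible;
      \<open>large2\<close> lets the gap between the rate and \<open>a\<close>, multiplied by
      \<open>k n\<close>, absorb the loss \<open>ln 2\<close>.\<close>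
    have large1: "\<forall>\<^sub>F n in sequentially. 4 * ln 4 / \<eta>\<^sup>2 \<le> k n"
      and large2: "\<forall>\<^sub>F n in sequentially. ln 2 / (- (1 / 2) - 2 * \<eta> - 2 * \<eta>\<^sup>2 - a) < k n"
      using k by (auto simp: filterlim_at_top
          intro: filterlim_at_top_dense[THEN iffD1, rule_format])
    have s: "1 + \<eta> > 0" "1 + 2 * \<eta> > 0" using \<eta> by auto
    show ?thesis
      using meas k_pos large1 large2 int[OF zero_less_one] int[OF s(1)] int[OF s(2)]
        moment[OF zero_less_one e] moment[OF s(1) e] moment[OF s(2) e]
    proof eventually_elim
      case (elim n)
      have large: "ln 4 \<le> k n * \<eta>\<^sup>2 / 4"
        using elim(3) \<eta>(1) by (simp add: field_simps)
      have bound: "prob {\<omega> \<in> space M. Y n \<omega> \<ge> 1} > 0"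
        "k n * (- (1 / 2) - 2 * \<eta> - 2 * \<eta>\<^sup>2) - ln 2 \<le> ln (prob {\<omega> \<in> space M. Y n \<omega> \<ge> 1})"
        using ln_prob_ge_1_lower_bound[of "Y n" "k n" \<eta>] elim large \<eta>(1) by auto
      have "ln 2 < k n * (- (1 / 2) - 2 * \<eta> - 2 * \<eta>\<^sup>2 - a)"
        using elim(4) \<eta>(2) by (simp add: pos_divide_less_eq)
      then have "k n * a < ln (prob {\<omega> \<in> space M. Y n \<omega> \<ge> 1})"
        using bound(2) by (simp add: algebra_simps)
      then show ?case
        using bound(1) elim(2) by (simp add: field_simps)
    qed
  qed
  show ?thesis
  proof (rule order_tendstoI)
    fix a :: real
    assume "a < - (1 / 2)"
    from lower[OF this] show
      "\<forall>\<^sub>F n in sequentially. a < 1 / k n * ln (prob {\<omega> \<in> space M. Y n \<omega> \<ge> 1})"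
      by (rule eventually_mono) auto
  next
    fix a :: real
    assume a: "- (1 / 2) < a"
    \<comment> \<open>With this \<open>e\<close> the Chernoff exponent \<open>e - 1 / 2\<close> is
      the midpoint of \<open>- 1 / 2\<close> and \<open>a\<close>.\<close>
    define e where "e = (a + 1 / 2) / 2"
    have e: "e > 0" using a by (simp add: e_def)
    \<comment> \<open>Any value below \<open>- 1 / 2\<close> would do in place of \<open>-1\<close>;
      only the positivity is used.\<close>
    have "\<forall>\<^sub>F n in sequentially. prob {\<omega> \<in> space M. Y n \<omega> \<ge> 1} > 0"
      using lower[of "-1"] by (auto elim: eventually_mono)
    then show "\<forall>\<^sub>F n in sequentially. 1 / k n * ln (prob {\<omega> \<in> space M. Y n \<omega> \<ge> 1}) < a"
      using meas k_pos int[OF zero_less_one] moment[OF zero_less_one e]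
    proof eventually_elim
      case (elim n)
      have "prob {\<omega> \<in> space M. Y n \<omega> \<ge> 1}
          \<le> exp (- k n) * expectation (\<lambda>\<omega>. exp (1 * k n * Y n \<omega>))"
        using elim by (intro prob_ge_1_le_exp_moment) auto
      also have "\<dots> \<le> exp (- k n) * exp (k n * (1\<^sup>2 / 2 + e))"
        using elim by (intro mult_left_mono) auto
      also have "\<dots> = exp (k n * (e - 1 / 2))"
        by (simp add: algebra_simps flip: exp_add)
      finally have "ln (prob {\<omega> \<in> space M. Y n \<omega> \<ge> 1}) \<le> k n * (e - 1 / 2)"
        using elim(1) by (metis ln_exp ln_mono)
      also have "\<dots> < k n * a"
        using elim(3) a by (intro mult_strict_left_mono) (auto simp: e_def)
      finally show ?case
        using elim(3) by (simp add: field_simps)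
    qed
  qed
qed

end

text \<open>The double limit is uniform over the region given by \<open>R\<close> and \<delta>, and
  a sequence with these limits eventually stays in that region.\<close>

lemma has_log_mgf_limit_sequentially:
  assumes L: "has_log_mgf_limit M X L"
    and r: "filterlim r at_top sequentially"
    and \<theta>: "\<forall>\<^sub>F n in sequentially. \<theta> n \<noteq> 0" "(\<lambda>n. \<theta> n * ln (r n)) \<longlonglongrightarrow> 0"
  shows "\<forall>\<^sub>F n in sequentially. integrable M (\<lambda>\<omega>. exp (\<theta> n * X 0 (r n) \<omega>))"
    and "(\<lambda>n. 1 / (r n * (\<theta> n)\<^sup>2) * ln (\<integral>\<omega>. exp (\<theta> n * X 0 (r n) \<omega>) \<partial>M)) \<longlonglongrightarrow> L"
proof -
  have *: "\<forall>\<^sub>F n in sequentially. integrable M (\<lambda>\<omega>. exp (\<theta> n * X 0 (r n) \<omega>)) \<and>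
      \<bar>1 / (r n * (\<theta> n)\<^sup>2) * ln (\<integral>\<omega>. exp (\<theta> n * X 0 (r n) \<omega>) \<partial>M) - L\<bar> \<le> e"
    if e: "e > 0" for e :: real
  proof -
    obtain R \<delta> where \<delta>: "\<delta> > 0" and
      bound: "\<And>\<rho> t. \<rho> \<ge> R \<Longrightarrow> t \<noteq> 0 \<Longrightarrow> \<bar>t\<bar> * ln \<rho> \<le> \<delta> \<Longrightarrow>
        integrable M (\<lambda>\<omega>. exp (t * X 0 \<rho> \<omega>)) \<and>
        \<bar>1 / (\<rho> * t\<^sup>2) * ln (\<integral>\<omega>. exp (t * X 0 \<rho> \<omega>) \<partial>M) - L\<bar> \<le> e"
      using L e unfolding has_log_mgf_limit_def by metis
    \<comment> \<open>From \<open>r n \<ge> 1\<close> it follows that \<open>ln (r n)\<close> is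
      nonnegative, so the constraint on \<open>\<bar>\<theta> n\<bar> * ln (r n)\<close> is one on
      \<open>\<bar>\<theta> n * ln (r n)\<bar>\<close>, which tends to \<open>0\<close>.\<close>
    have "\<forall>\<^sub>F n in sequentially. r n \<ge> R" "\<forall>\<^sub>F n in sequentially. r n \<ge> 1"
      using r by (auto simp: filterlim_at_top)
    then show ?thesis
      using \<theta>(1) tendstoD[OF \<theta>(2) \<delta>]
    proof eventually_elim
      case (elim n)
      then show ?case
        by (intro bound) (auto simp: abs_mult)
    qed
  qed
  show "\<forall>\<^sub>F n in sequentially. integrable M (\<lambda>\<omega>. exp (\<theta> n * X 0 (r n) \<omega>))"
    using *[of 1] by (auto elim: eventually_mono)
  show "(\<lambda>n. 1 / (r n * (\<theta> n)\<^sup>2) * ln (\<integral>\<omega>. exp (\<theta> n * X 0 (r n) \<omega>) \<partial>M)) \<longlonglongrightarrow> L"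
  proof (rule tendstoI)
    fix e :: real
    assume "e > 0"
    \<comment> \<open>Halving turns the weak inequality of \<open>*\<close> into the strict one
      required here.\<close>
    then have "e / 2 > 0" by simp
    from *[OF this] show "\<forall>\<^sub>F n in sequentially.
        dist (1 / (r n * (\<theta> n)\<^sup>2) * ln (\<integral>\<omega>. exp (\<theta> n * X 0 (r n) \<omega>) \<partial>M)) L < e"
      by (rule eventually_mono) (use \<open>e > 0\<close> in \<open>auto simp: dist_real_def\<close>)
  qed
qed

theorem corollary1p7:
  fixes M :: "'a measure" and X :: "real \<Rightarrow> real \<Rightarrow> 'a \<Rightarrow> real"
    and \<sigma> :: real and r c :: "nat \<Rightarrow> real"
  assumes "splittable TYPE('b) M X"
    and "\<sigma> \<ge> 0"
    and "has_log_mgf_limit M X (\<sigma>\<^sup>2 / 2)"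
    and "\<sigma> \<noteq> 0"
    and "filterlim r at_top sequentially"
    and "filterlim c at_top sequentially"
    and "(\<lambda>n. (c n * ln (r n))\<^sup>2 / r n) \<longlonglongrightarrow> 0"
  shows "(\<lambda>n. 1 / (c n)\<^sup>2 *
            ln (measure M {\<omega> \<in> space M. X 0 (r n) \<omega> \<ge> c n * \<sigma> * sqrt (r n)}))
         \<longlonglongrightarrow> - (1 / 2)"
proof -
  have "process M X"
    using assms(1) by (simp add: splittable_def)
  then interpret prob_space M
    by (simp add: process_def)
  have X: "X 0 t \<in> borel_measurable M" if "t > 0" for t
    using \<open>process M X\<close> that by (simp add: process_def)
  have \<sigma>: "\<sigma> > 0" using assms by simp
  have pos: "\<forall>\<^sub>F n in sequentially. r n > 0 \<and> c n > 0"
    using assms(5,6) by (simp add: filterlim_at_top_dense eventually_conj)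
  \<comment> \<open>This scaling turns the event into \<open>Y n \<omega> \<ge> 1\<close>, at speed
    \<open>(c n)^2\<close>.\<close>
  define Y where "Y n \<omega> = X 0 (r n) \<omega> / (c n * \<sigma> * sqrt (r n))" for n \<omega>
  have meas: "\<forall>\<^sub>F n in sequentially. Y n \<in> borel_measurable M"
    using pos
    by (rule eventually_mono) (unfold Y_def[abs_def], intro borel_measurable_divide X; simp)
  have k: "filterlim (\<lambda>n. (c n)\<^sup>2) at_top sequentially"
    using assms(6) by (rule filterlim_pow_at_top[rotated]) simp
  have moments: "\<forall>\<^sub>F n in sequentially. integrable M (\<lambda>\<omega>. exp (s * (c n)\<^sup>2 * Y n \<omega>))"
    "(\<lambda>n. 1 / (c n)\<^sup>2 * ln (expectation (\<lambda>\<omega>. exp (s * (c n)\<^sup>2 * Y n \<omega>)))) \<longlonglongrightarrow> s\<^sup>2 / 2"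
    if s: "s > 0" for s
  proof -
    define \<theta> where "\<theta> n = s * c n / (\<sigma> * sqrt (r n))" for n
    have \<theta>_nz: "\<forall>\<^sub>F n in sequentially. \<theta> n \<noteq> 0"
      using pos by (rule eventually_mono) (use s \<sigma> in \<open>auto simp: \<theta>_def\<close>)
    \<comment> \<open>The square root of the quantity in the regime assumption is
      \<open>\<bar>c n * ln (r n)\<bar> / sqrt (r n)\<close>. It determines
      \<open>\<theta> n * ln (r n)\<close> only up to sign, hence the passage through absolute
      values.\<close>
    have "(\<lambda>n. s / \<sigma> * sqrt ((c n * ln (r n))\<^sup>2 / r n)) \<longlonglongrightarrow> s / \<sigma> * sqrt 0"
      by (intro tendsto_intros assms(7))
    then have "(\<lambda>n. \<bar>s / \<sigma> * sqrt ((c n * ln (r n))\<^sup>2 / r n)\<bar>) \<longlonglongrightarrow> 0"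
      by (intro tendsto_rabs_zero) simp
    then have "(\<lambda>n. \<bar>\<theta> n * ln (r n)\<bar>) \<longlonglongrightarrow> 0"
    proof (rule Lim_transform_eventually)
      show "\<forall>\<^sub>F n in sequentially.
          \<bar>s / \<sigma> * sqrt ((c n * ln (r n))\<^sup>2 / r n)\<bar> = \<bar>\<theta> n * ln (r n)\<bar>"
        using pos by (rule eventually_mono) (auto simp: \<theta>_def real_sqrt_divide abs_mult)
    qed
    then have \<theta>_lim: "(\<lambda>n. \<theta> n * ln (r n)) \<longlonglongrightarrow> 0"
      by (simp only: tendsto_rabs_zero_iff)
    have \<theta>_Y: "\<forall>\<^sub>F n in sequentially. r n * (\<theta> n)\<^sup>2 = s\<^sup>2 / \<sigma>\<^sup>2 * (c n)\<^sup>2 \<and>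
        (\<forall>\<omega>. \<theta> n * X 0 (r n) \<omega> = s * (c n)\<^sup>2 * Y n \<omega>)"
      using pos by (rule eventually_mono)
        (use \<sigma> in \<open>auto simp: \<theta>_def Y_def field_simps power2_eq_square\<close>)
    note mgf = has_log_mgf_limit_sequentially[OF assms(3,5) \<theta>_nz \<theta>_lim]
    from mgf(1) \<theta>_Y
    show "\<forall>\<^sub>F n in sequentially. integrable M (\<lambda>\<omega>. exp (s * (c n)\<^sup>2 * Y n \<omega>))"
      by eventually_elim simp
    \<comment> \<open>The factor \<open>s^2 / \<sigma>^2\<close> changes the normalisation
      \<open>1 / (r n * (\<theta> n)^2)\<close> into \<open>1 / (c n)^2\<close>, and the limit
      \<open>\<sigma>^2 / 2\<close> into \<open>s^2 / 2\<close>.\<close>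
    have "(\<lambda>n. s\<^sup>2 / \<sigma>\<^sup>2 * (1 / (r n * (\<theta> n)\<^sup>2) * ln (\<integral>\<omega>. exp (\<theta> n * X 0 (r n) \<omega>) \<partial>M)))
        \<longlonglongrightarrow> s\<^sup>2 / \<sigma>\<^sup>2 * (\<sigma>\<^sup>2 / 2)"
      by (intro tendsto_mult_left mgf(2))
    also have "s\<^sup>2 / \<sigma>\<^sup>2 * (\<sigma>\<^sup>2 / 2) = s\<^sup>2 / 2"
      using \<sigma> by simp
    finally show
      "(\<lambda>n. 1 / (c n)\<^sup>2 * ln (expectation (\<lambda>\<omega>. exp (s * (c n)\<^sup>2 * Y n \<omega>)))) \<longlonglongrightarrow> s\<^sup>2 / 2"
      by (rule Lim_transform_eventually)
        (use \<theta>_Y in \<open>rule eventually_mono; use s \<sigma> in simp\<close>)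
  qed
  from gaussian_Gaertner_Ellis[OF meas k moments]
  have "(\<lambda>n. 1 / (c n)\<^sup>2 * ln (prob {\<omega> \<in> space M. Y n \<omega> \<ge> 1})) \<longlonglongrightarrow> - (1 / 2)"
    by simp
  then show ?thesis
  proof (rule Lim_transform_eventually)
    show "\<forall>\<^sub>F n in sequentially. 1 / (c n)\<^sup>2 * ln (prob {\<omega> \<in> space M. Y n \<omega> \<ge> 1})
        = 1 / (c n)\<^sup>2 * ln (prob {\<omega> \<in> space M. X 0 (r n) \<omega> \<ge> c n * \<sigma> * sqrt (r n)})"
      using pos
    proof eventually_elim
      case (elim n)
      then have "c n * \<sigma> * sqrt (r n) > 0" using \<sigma> by simp
      then show ?case by (simp add: Y_def)
    qed
  qed
qed

end
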